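(* Let $G$ be a group, let $M=G^0=G\sqcup\{0\}$ be the monoid obtained from $G$ by adjoining a zero element, and let $\alpha$ be a strong partial action of $M$ on a semigroup $X$ such that $\operatorname{dom}\alpha_m$ and $\operatorname{im}\alpha_m$ are ideals of $X$ for all $m\in M$. Then the rewriting system $(X_M^+,\to)$ associated with $\alpha$ is locally confluent if and only if all three of the following conditions hold: (LC1) for all $g\in G$ and $x,y,z\in X$ with $y\in\operatorname{dom}\alpha_g$: $\alpha_{g^{-1}}(\alpha_g(xy)z)=x\,\alpha_{g^{-1}}(\alpha_g(y)z)$; (LC2) for all $m\in M$, $y\in\operatorname{dom}\alpha_m$ and $x,z\in X^1$: if $xyz\in\operatorname{dom}\alpha_0$, then $x\alpha_m(y)z\in\operatorname{dom}\alpha_0$ and $\alpha_0(xyz)=\alpha_0(x\alpha_m(y)z)$; (LC3) for all $g,h\in G$, $x\in\operatorname{dom}\alpha_g$, $y\in\operatorname{dom}\alpha_h$ and $z\in X^1$: if $xyz\notin\operatorname{dom}\alpha_0$, then there exists $k\in G$ such that $xyz\in\operatorname{dom}\alpha_k$ and $\alpha_k(xyz)=\alpha_g(x)\alpha_h(y)z$.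
   Context: Let $M$ be a monoid with identity $e$. A strong partial action of $M$ on a set $X$ is a family $\alpha=\{\alpha_m:\operatorname{dom}\alpha_m\to X\}_{m\in M}$ of maps with $\operatorname{dom}\alpha_m\subseteq X$ such that: (1) $\operatorname{dom}\alpha_e=X$ and $\alpha_e=\mathrm{id}_X$; (2) $\alpha_m^{-1}(\operatorname{dom}\alpha_n)=\operatorname{dom}\alpha_{nm}\cap\operatorname{dom}\alpha_m$ for all $m,n\in M$; (3) $\alpha_n\circ\alpha_m=\alpha_{nm}$ on $\alpha_m^{-1}(\operatorname{dom}\alpha_n)$ for all $m,n\in M$. A strong partial action of $M$ on a semigroup $X$ is one on the underlying set such that each $\operatorname{dom}\alpha_m$ is a subsemigroup of $X$ and each $\alpha_m$ is a semigroup homomorphism. Write $\operatorname{im}\alpha_m=\alpha_m(\operatorname{dom}\alpha_m)$. Ideals are two-sided; subsemigroups and ideals are allowed to be empty. $X^1$ denotes the semigroup $X$ with an identity element $1$ adjoined. $X_M=(M\times X)/{\approx}$, where $\approx$ is the equivalence relation generated by: $(m,x)\rightharpoonup(n,y)$ iff there is $k\in M$ with $m=nk$, $x\in\operatorname{dom}\alpha_k$ and $y=\alpha_k(x)$. The class of $(m,x)$ is $[m,x]$. $X_M^+$ is the free semigroup on $X_M$ (nonempty words), and $X_M^*$ the free monoid. The relation $\to$ on $X_M^+$ is: $u[m,x][m,y]v\to u[m,xy]v$ for all $u,v\in X_M^*$, $m\in M$, $x,y\in X$ (where letters are elements of $X_M$, so any representatives may be used). $\overset{*}{\to}$ is the reflexive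 transitive closure of $\to$. A word $w$ is locally confluent if whenever $w\to w_1$ and $w\to w_2$ there is $w'$ with $w_1\overset{*}{\to}w'$ and $w_2\overset{*}{\to}w'$; $(X_M^+,\to)$ is locally confluent if every word is. *)

theory Defs
  imports "HOL-Algebra.Group"
begin

(* Semigroups, possibly empty, are (carrier, mult) reducts of HOL-Algebra's monoid records;
   the field one is never referred to. *)

locale semigroup_struct =
  fixes X (structure)
  assumes m_closed: "\<lbrakk>x \<in> carrier X; y \<in> carrier X\<rbrakk> \<Longrightarrow> x \<otimes> y \<in> carrier X"
    and m_assoc: "\<lbrakk>x \<in> carrier X; y \<in> carrier X; z \<in> carrier X\<rbrakk>
      \<Longrightarrow> (x \<otimes> y) \<otimes> z = x \<otimes> (y \<otimes> z)"

definition subsemigroup :: "'x set \<Rightarrow> ('x, 'b) monoid_scheme \<Rightarrow> bool" where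
  "subsemigroup S X \<longleftrightarrow> S \<subseteq> carrier X \<and> (\<forall>x\<in>S. \<forall>y\<in>S. x \<otimes>\<^bsub>X\<^esub> y \<in> S)"

definition semigroup_ideal :: "'x set \<Rightarrow> ('x, 'b) monoid_scheme \<Rightarrow> bool" where
  "semigroup_ideal I X \<longleftrightarrow> I \<subseteq> carrier X \<and>
     (\<forall>i\<in>I. \<forall>x\<in>carrier X. x \<otimes>\<^bsub>X\<^esub> i \<in> I \<and> i \<otimes>\<^bsub>X\<^esub> x \<in> I)"

(* G^0: None is the new zero element. *)
definition adjoin_zero :: "('g, 'b) monoid_scheme \<Rightarrow> 'g option monoid" where
  "adjoin_zero G =
    \<lparr>carrier = insert None (Some ` carrier G),
     mult = (\<lambda>a b. case (a, b) of (Some g, Some h) \<Rightarrow> Some (g \<otimes>\<^bsub>G\<^esub> h) | _ \<Rightarrow> None),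
     one = Some \<one>\<^bsub>G\<^esub>\<rparr>"

(* X^1: None is the new identity element. *)
definition adjoin_one :: "('x, 'b) monoid_scheme \<Rightarrow> 'x option monoid" where
  "adjoin_one X =
    \<lparr>carrier = insert None (Some ` carrier X),
     mult = (\<lambda>a b. case (a, b) of
        (Some x, Some y) \<Rightarrow> Some (x \<otimes>\<^bsub>X\<^esub> y) | (None, _) \<Rightarrow> b | (_, None) \<Rightarrow> a),
     one = None\<rparr>"

(* The product x y z for y in X and x, z in X^1.  It lies in X, so it is never None. *)
definition prod1 :: "('x, 'b) monoid_scheme \<Rightarrow> 'x option \<Rightarrow> 'x \<Rightarrow> 'x option \<Rightarrow> 'x" where
  "prod1 X x y z = the (x \<otimes>\<^bsub>adjoin_one X\<^esub> Some y \<otimes>\<^bsub>adjoin_one X\<^esub> z)"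

lemma monoid_adjoin_zero: "group G \<Longrightarrow> monoid (adjoin_zero G)"
proof -
  assume "group G"
  then interpret group G .
  show ?thesis
    by unfold_locales (auto simp: adjoin_zero_def m_assoc split: option.splits)
qed

lemma monoid_adjoin_one: "semigroup_struct X \<Longrightarrow> monoid (adjoin_one X)"
proof -
  assume "semigroup_struct X"
  then interpret semigroup_struct X .
  show ?thesis
    by unfold_locales (auto simp: adjoin_one_def m_closed m_assoc split: option.splits)
qed

lemma Some_prod1: "Some (prod1 X x y z) = x \<otimes>\<^bsub>adjoin_one X\<^esub> Some y \<otimes>\<^bsub>adjoin_one X\<^esub> z"
  by (auto simp: prod1_def adjoin_one_def split: option.splits)

(* The partial map \<alpha>_m is given by its domain D m and the total function \<alpha> m, whose values
   outside D m are irrelevant. *)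
locale strong_partial_action = monoid M for M (structure) +
  fixes S :: "'x set" and D :: "'a \<Rightarrow> 'x set" and \<alpha> :: "'a \<Rightarrow> 'x \<Rightarrow> 'x"
  assumes dom_subset: "m \<in> carrier M \<Longrightarrow> D m \<subseteq> S"
    and act_closed: "m \<in> carrier M \<Longrightarrow> \<alpha> m \<in> D m \<rightarrow> S"
    and dom_one: "D \<one> = S"
    and act_one: "x \<in> S \<Longrightarrow> \<alpha> \<one> x = x"
    and dom_mult: "\<lbrakk>m \<in> carrier M; n \<in> carrier M\<rbrakk>
      \<Longrightarrow> {x \<in> D m. \<alpha> m x \<in> D n} = D (n \<otimes> m) \<inter> D m"
    and act_mult: "\<lbrakk>m \<in> carrier M; n \<in> carrier M; x \<in> D m; \<alpha> m x \<in> D n\<rbrakk>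
      \<Longrightarrow> \<alpha> n (\<alpha> m x) = \<alpha> (n \<otimes> m) x"

locale strong_partial_action_semigroup =
  strong_partial_action M "carrier X" D \<alpha> + semigroup_struct X
  for M :: "('m, 'b) monoid_scheme" and X :: "('x, 'c) monoid_scheme"
    and D :: "'m \<Rightarrow> 'x set" and \<alpha> :: "'m \<Rightarrow> 'x \<Rightarrow> 'x" +
  assumes dom_subsemigroup: "m \<in> carrier M \<Longrightarrow> subsemigroup (D m) X"
    and act_hom: "m \<in> carrier M \<Longrightarrow> \<alpha> m \<in> hom (X\<lparr>carrier := D m\<rparr>) X"

definition tensor_step ::
  "('m, 'b) monoid_scheme \<Rightarrow> ('x, 'c) monoid_scheme \<Rightarrow> ('m \<Rightarrow> 'x set) \<Rightarrow> ('m \<Rightarrow> 'x \<Rightarrow> 'x)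
    \<Rightarrow> 'm \<times> 'x \<Rightarrow> 'm \<times> 'x \<Rightarrow> bool" where
  "tensor_step M X D \<alpha> p q \<longleftrightarrow>
     p \<in> carrier M \<times> carrier X \<and> q \<in> carrier M \<times> carrier X \<and>
     (\<exists>k\<in>carrier M. fst p = fst q \<otimes>\<^bsub>M\<^esub> k \<and> snd p \<in> D k \<and> snd q = \<alpha> k (snd p))"

definition tensor_rel ::
  "('m, 'b) monoid_scheme \<Rightarrow> ('x, 'c) monoid_scheme \<Rightarrow> ('m \<Rightarrow> 'x set) \<Rightarrow> ('m \<Rightarrow> 'x \<Rightarrow> 'x)
    \<Rightarrow> (('m \<times> 'x) \<times> ('m \<times> 'x)) set" where
  "tensor_rel M X D \<alpha> = {(p, q). p \<in> carrier M \<times> carrier X \<and> q \<in> carrier M \<times> carrier X \<and>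
     equivclp (tensor_step M X D \<alpha>) p q}"

lemma equiv_tensor_rel: "equiv (carrier M \<times> carrier X) (tensor_rel M X D \<alpha>)"
  by (intro equivI refl_onI symI transI)
    (auto simp: tensor_rel_def intro: equivclp_sym equivclp_trans)

definition tensor_class ::
  "('m, 'b) monoid_scheme \<Rightarrow> ('x, 'c) monoid_scheme \<Rightarrow> ('m \<Rightarrow> 'x set) \<Rightarrow> ('m \<Rightarrow> 'x \<Rightarrow> 'x)
    \<Rightarrow> 'm \<Rightarrow> 'x \<Rightarrow> ('m \<times> 'x) set" where
  "tensor_class M X D \<alpha> m x = tensor_rel M X D \<alpha> `` {(m, x)}"

definition tensor_set ::
  "('m, 'b) monoid_scheme \<Rightarrow> ('x, 'c) monoid_scheme \<Rightarrow> ('m \<Rightarrow> 'x set) \<Rightarrow> ('m \<Rightarrow> 'x \<Rightarrow> 'x)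
    \<Rightarrow> ('m \<times> 'x) set set" where
  "tensor_set M X D \<alpha> = (carrier M \<times> carrier X) // tensor_rel M X D \<alpha>"

(* The free monoid on A is lists A. *)
definition nonempty_words :: "'l set \<Rightarrow> 'l list set" where
  "nonempty_words A = lists A - {[]}"

definition rewrite_step ::
  "('m, 'b) monoid_scheme \<Rightarrow> ('x, 'c) monoid_scheme \<Rightarrow> ('m \<Rightarrow> 'x set) \<Rightarrow> ('m \<Rightarrow> 'x \<Rightarrow> 'x)
    \<Rightarrow> ('m \<times> 'x) set list \<Rightarrow> ('m \<times> 'x) set list \<Rightarrow> bool" where
  "rewrite_step M X D \<alpha> w w' \<longleftrightarrow>
     (\<exists>u\<in>lists (tensor_set M X D \<alpha>). \<exists>v\<in>lists (tensor_set M X D \<alpha>).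
      \<exists>m\<in>carrier M. \<exists>x\<in>carrier X. \<exists>y\<in>carrier X.
        w = u @ [tensor_class M X D \<alpha> m x, tensor_class M X D \<alpha> m y] @ v \<and>
        w' = u @ [tensor_class M X D \<alpha> m (x \<otimes>\<^bsub>X\<^esub> y)] @ v)"

definition locally_confluent_at :: "('w \<Rightarrow> 'w \<Rightarrow> bool) \<Rightarrow> 'w \<Rightarrow> bool" where
  "locally_confluent_at R w \<longleftrightarrow>
     (\<forall>w1 w2. R w w1 \<and> R w w2 \<longrightarrow> (\<exists>w'. R\<^sup>*\<^sup>* w1 w' \<and> R\<^sup>*\<^sup>* w2 w'))"

definition locally_confluent_on :: "'w set \<Rightarrow> ('w \<Rightarrow> 'w \<Rightarrow> bool) \<Rightarrow> bool" where
  "locally_confluent_on W R \<longleftrightarrow> (\<forall>w\<in>W. locally_confluent_at R w)"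

end

theory Submission
  imports Defs
begin

text \<open>Only two kinds of critical pairs occur: two contractions of the same pair of letters, and two
  contractions overlapping in a middle letter. An equality between letters $[m,x]$ and $[n,y]$ with
  $m \in G$ determines $x$ from $y$, so a pair of letters with a representative over $G$ has a
  unique contractum. Hence contractions are unique iff equality of the classes $[0,x]$ is a
  congruence on $X$, and this is (LC2) and (LC3) together. Given that congruence, an overlap whose
  middle letter has a representative over $0$ resolves over $0$, since $\operatorname{im}\alpha_0$
  is an ideal on which the component in $M$ can be changed freely. An overlap whose middle letter
  equals $[g,y] = [e,\alpha_g(y)]$ resolves exactly when (LC1) holds.\<close>

section \<open>Critical pairs of letter contractions\<close>

text \<open>Forgets how letters are represented: \<open>r\<close> is an arbitrary ternary relation
  on letters. It is a relation and not a function because different common representatives of the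
  same pair may give different contracta.\<close>

definition contraction_step :: "'l set \<Rightarrow> ('l \<Rightarrow> 'l \<Rightarrow> 'l \<Rightarrow> bool) \<Rightarrow> 'l list \<Rightarrow> 'l list \<Rightarrow> bool" where
  "contraction_step A r w w' \<longleftrightarrow>
     (\<exists>u\<in>lists A. \<exists>v\<in>lists A. \<exists>a b c. r a b c \<and> w = u @ [a, b] @ v \<and> w' = u @ [c] @ v)"

lemma contraction_stepI:
  "\<lbrakk>r a b c; u \<in> lists A; v \<in> lists A\<rbrakk> \<Longrightarrow> contraction_step A r (u @ [a, b] @ v) (u @ [c] @ v)"
  unfolding contraction_step_def by blast

lemma not_contraction_step_singleton: "\<not> contraction_step A r [a] w"
  by (auto simp: contraction_step_def Cons_eq_append_conv)

lemma contraction_step_pair: "contraction_step A r [a, b] w \<longleftrightarrow> (\<exists>c. r a b c \<and> w = [c])"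
  by (force simp: contraction_step_def Cons_eq_append_conv)

lemma contraction_steps_singleton: "(contraction_step A r)\<^sup>*\<^sup>* [a] w \<Longrightarrow> w = [a]"
  by (erule converse_rtranclpE) (auto simp: not_contraction_step_singleton)

lemma contraction_steps_pair:
  "(contraction_step A r)\<^sup>*\<^sup>* [a, b] w \<Longrightarrow> w = [a, b] \<or> (\<exists>c. r a b c \<and> w = [c])"
  by (erule converse_rtranclpE)
    (auto simp: contraction_step_pair dest: contraction_steps_singleton)

text \<open>A redex occupies two positions, so the starting points of two redexes differ by 0, by 1,
  or by at least 2. The length assumption fixes which of them comes first.\<close>

lemma two_redexes_cases:
  assumes "u @ [a, b] @ v = u' @ [a', b'] @ v'" and "length u \<le> length u'"
  obtains (same) "u' = u" "a' = a" "b' = b" "v' = v"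
  | (overlap) "u' = u @ [a]" "a' = b" "v = b' # v'"
  | (disjoint) t where "u' = u @ [a, b] @ t" "v = t @ [a', b'] @ v'"
proof -
  from assms obtain t where t: "u' = u @ t" "[a, b] @ v = t @ [a', b'] @ v'"
    by (auto simp: append_eq_append_conv2)
  show thesis
  proof (cases t)
    case Nil
    with t same show ?thesis by simp
  next
    case (Cons s t')
    with t overlap disjoint show ?thesis
      by (cases t') auto
  qed
qed

text \<open>Words of two and three letters serve as tests: one letter is irreducible and two letters
  can only shrink to one, so joinability there becomes an equation or a common contractum. The
  alternative \<open>d = a \<and> c = f\<close> is the case where the two reducts coincide as words.
  Conversely, disjoint redexes commute and a resolved critical pair stays resolved in any
  context.\<close>

lemma locally_confluent_contraction_iff:
  assumes closed: "\<And>a b c. r a b c \<Longrightarrow> a \<in> A \<and> b \<in> A \<and> c \<in> A"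
  shows "locally_confluent_on (nonempty_words A) (contraction_step A r) \<longleftrightarrow>
    (\<forall>a b c c'. r a b c \<and> r a b c' \<longrightarrow> c = c') \<and>
    (\<forall>a b c d f. r a b d \<and> r b c f \<longrightarrow> d = a \<and> c = f \<or> (\<exists>s. r d c s \<and> r a f s))"
    (is "?L \<longleftrightarrow> ?det \<and> ?overlap")
proof
  assume L: ?L
  have join: "\<exists>w'. (contraction_step A r)\<^sup>*\<^sup>* w1 w' \<and> (contraction_step A r)\<^sup>*\<^sup>* w2 w'"
    if "w \<in> nonempty_words A" "contraction_step A r w w1" "contraction_step A r w w2" for w w1 w2
    using L that unfolding locally_confluent_on_def locally_confluent_at_def by blast
  have ?det
  proof (intro allI impI)
    fix a b c c' assume "r a b c \<and> r a b c'"
    then obtain w' where "(contraction_step A r)\<^sup>*\<^sup>* [c] w'" "(contraction_step A r)\<^sup>*\<^sup>* [c'] w'"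
      using join[of "[a, b]" "[c]" "[c']"] closed
      by (auto simp: contraction_step_pair nonempty_words_def)
    then show "c = c'"
      by (auto dest!: contraction_steps_singleton)
  qed
  moreover have ?overlap
  proof (intro allI impI)
    fix a b c d f assume r: "r a b d \<and> r b c f"
    then have "contraction_step A r [a, b, c] [d, c]" "contraction_step A r [a, b, c] [a, f]"
      using contraction_stepI[of r a b d "[]" A "[c]"] contraction_stepI[of r b c f "[a]" A "[]"]
        closed by auto
    then obtain w' where "(contraction_step A r)\<^sup>*\<^sup>* [d, c] w'" "(contraction_step A r)\<^sup>*\<^sup>* [a, f] w'"
      using join[of "[a, b, c]" "[d, c]" "[a, f]"] closed r
      by (auto simp: nonempty_words_def)
    then show "d = a \<and> c = f \<or> (\<exists>s. r d c s \<and> r a f s)"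
      by (auto dest!: contraction_steps_pair)
  qed
  ultimately show "?det \<and> ?overlap" ..
next
  assume crit: "?det \<and> ?overlap"
  let ?J = "\<lambda>w1 w2. \<exists>w'. (contraction_step A r)\<^sup>*\<^sup>* w1 w' \<and> (contraction_step A r)\<^sup>*\<^sup>* w2 w'"
  have joinable: "?J (u @ [c] @ v) (u' @ [c'] @ v')"
    if "u @ [a, b] @ v = u' @ [a', b'] @ v'" "length u \<le> length u'"
      "r a b c" "r a' b' c'" "u \<in> lists A" "v \<in> lists A" "u' \<in> lists A" "v' \<in> lists A"
    for u v u' v' a b c a' b' c'
    using that(1,2)
  proof (cases rule: two_redexes_cases)
    case same
    then show ?thesis using crit that(3,4) by blast
  next
    case overlap
    with crit that(3,4) consider "c = a" "b' = c'" | s where "r c b' s" "r a c' s"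
      by blast
    then show ?thesis
    proof cases
      case 1
      with overlap show ?thesis by auto
    next
      case (2 s)
      have "contraction_step A r (u @ [c] @ v) (u @ [s] @ v')"
        using contraction_stepI[of r c b' s u A v'] 2(1) that(5,8) overlap by simp
      moreover have "contraction_step A r (u' @ [c'] @ v') (u @ [s] @ v')"
        using contraction_stepI[of r a c' s u A v'] 2(2) that(5,8) overlap by simp
      ultimately show ?thesis by blast
    qed
  next
    case (disjoint t)
    have "contraction_step A r (u @ [c] @ v) (u @ [c] @ t @ [c'] @ v')"
      using contraction_stepI[of r a' b' c' "u @ [c] @ t" A v'] closed[OF that(3)] disjoint that
      by simp
    moreover have "contraction_step A r (u' @ [c'] @ v') (u @ [c] @ t @ [c'] @ v')"
      using contraction_stepI[of r a b c u A "t @ [c'] @ v'"] closed[OF that(4)] disjoint that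
      by simp
    ultimately show ?thesis by blast
  qed
  show ?L
    unfolding locally_confluent_on_def locally_confluent_at_def
  proof (intro ballI allI impI)
    fix w w1 w2 assume "contraction_step A r w w1 \<and> contraction_step A r w w2"
    then obtain u v a b c u' v' a' b' c' where *:
      "w = u @ [a, b] @ v" "w1 = u @ [c] @ v" "r a b c" "u \<in> lists A" "v \<in> lists A"
      "w = u' @ [a', b'] @ v'" "w2 = u' @ [c'] @ v'" "r a' b' c'" "u' \<in> lists A" "v' \<in> lists A"
      unfolding contraction_step_def by blast
    show "?J w1 w2"
      using joinable[of u a b v u' a' b' v' c c'] joinable[of u' a' b' v' u a b v c' c] *
      \<comment> \<open>\<open>joinable\<close> assumes that the first redex starts no later than
        the second, so it is invoked with both orders of the two redexes.\<close>
      by (metis nat_le_linear)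
  qed
qed

section \<open>Equality of tensor classes\<close>

locale group_zero_partial_action = group G + X: semigroup_struct X
  for G :: "('g, 'b) monoid_scheme" (structure)
    and X :: "('x, 'c) monoid_scheme" (structure) +
  fixes D :: "'g option \<Rightarrow> 'x set" and \<alpha> :: "'g option \<Rightarrow> 'x \<Rightarrow> 'x"
  assumes action: "strong_partial_action_semigroup (adjoin_zero G) X D \<alpha>"
    and dom_ideal: "m \<in> carrier (adjoin_zero G) \<Longrightarrow> semigroup_ideal (D m) X"
    and im_ideal: "m \<in> carrier (adjoin_zero G) \<Longrightarrow> semigroup_ideal (\<alpha> m ` D m) X"
begin

section \<open>Rules of calculation for a partial action of a group with zero\<close>

abbreviation "M \<equiv> adjoin_zero G"

abbreviation prodX (infixl "\<cdot>" 70) where "x \<cdot> y \<equiv> x \<otimes>\<^bsub>X\<^esub> y"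

abbreviation "cls \<equiv> tensor_class M X D \<alpha>"

interpretation A: strong_partial_action_semigroup M X D \<alpha>
  by (rule action)

lemma carrier_M [simp]: "None \<in> carrier M" "Some g \<in> carrier M \<longleftrightarrow> g \<in> carrier G"
  by (auto simp: adjoin_zero_def)

lemma mult_M [simp]:
  "None \<otimes>\<^bsub>M\<^esub> m = None" "m \<otimes>\<^bsub>M\<^esub> None = None" "Some g \<otimes>\<^bsub>M\<^esub> Some h = Some (g \<otimes> h)"
  by (auto simp: adjoin_zero_def split: option.splits)

lemma one_M: "\<one>\<^bsub>M\<^esub> = Some \<one>"
  by (simp add: adjoin_zero_def)

lemma dom_carrier: "\<lbrakk>x \<in> D m; m \<in> carrier M\<rbrakk> \<Longrightarrow> x \<in> carrier X"
  using A.dom_subset by blast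

lemma act_carrier: "\<lbrakk>x \<in> D m; m \<in> carrier M\<rbrakk> \<Longrightarrow> \<alpha> m x \<in> carrier X"
  using A.act_closed by blast

lemma act_prod: "\<lbrakk>m \<in> carrier M; x \<in> D m; y \<in> D m\<rbrakk> \<Longrightarrow> \<alpha> m (x \<cdot> y) = \<alpha> m x \<cdot> \<alpha> m y"
  using A.act_hom[of m] by (auto simp: hom_def)

lemma dom_one [simp]: "D (Some \<one>) = carrier X"
  using A.dom_one by (simp add: one_M)

lemma act_one [simp]: "x \<in> carrier X \<Longrightarrow> \<alpha> (Some \<one>) x = x"
  using A.act_one by (simp add: one_M)

lemma dom_mult_iff:
  "\<lbrakk>m \<in> carrier M; n \<in> carrier M; x \<in> D m\<rbrakk> \<Longrightarrow> \<alpha> m x \<in> D n \<longleftrightarrow> x \<in> D (n \<otimes>\<^bsub>M\<^esub> m)"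
  using A.dom_mult[of m n] by blast

lemma act_mult:
  "\<lbrakk>m \<in> carrier M; n \<in> carrier M; x \<in> D m; x \<in> D (n \<otimes>\<^bsub>M\<^esub> m)\<rbrakk> \<Longrightarrow> \<alpha> n (\<alpha> m x) = \<alpha> (n \<otimes>\<^bsub>M\<^esub> m) x"
  using A.act_mult[of m n x] dom_mult_iff[of m n x] by blast

lemma dom_prod:
  assumes "m \<in> carrier M" "x \<in> D m" "y \<in> carrier X"
  shows "x \<cdot> y \<in> D m" "y \<cdot> x \<in> D m"
  using dom_ideal[OF assms(1)] assms(2,3) by (auto simp: semigroup_ideal_def)

text \<open>From 0m = 0: no \<alpha>_m leads into or out of dom \<alpha>_0, and, by the next lemma,
  \<alpha>_0 is constant along \<alpha>_m there.\<close>

lemma act_in_dom_zero: "\<lbrakk>m \<in> carrier M; x \<in> D m\<rbrakk> \<Longrightarrow> \<alpha> m x \<in> D None \<longleftrightarrow> x \<in> D None"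
  using dom_mult_iff[of m None x] by simp

lemma zero_act: "\<lbrakk>m \<in> carrier M; x \<in> D m; x \<in> D None\<rbrakk> \<Longrightarrow> \<alpha> None (\<alpha> m x) = \<alpha> None x"
  using act_mult[of m None x] by simp

text \<open>From m0 = 0: im \<alpha>_0 lies in every domain and is fixed pointwise by every
  \<alpha>_m.\<close>

lemma act_zero:
  assumes "m \<in> carrier M" "x \<in> D None"
  shows "\<alpha> None x \<in> D m" "\<alpha> m (\<alpha> None x) = \<alpha> None x"
  using dom_mult_iff[of None m x] act_mult[of None m x] assms by simp_all

text \<open>The product of \<open>inv g\<close> and \<open>g\<close> is the identity, whose domain
  is all of X. So \<alpha>_g is injective, and the partial map of the inverse undoes it.\<close>

lemma act_inv:
  assumes "g \<in> carrier G" "x \<in> D (Some g)"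
  shows "\<alpha> (Some g) x \<in> D (Some (inv g))" "\<alpha> (Some (inv g)) (\<alpha> (Some g) x) = x"
  using dom_mult_iff[of "Some g" "Some (inv g)" x] act_mult[of "Some g" "Some (inv g)" x] assms
    dom_carrier[of x "Some g"] by simp_all

lemma mult_inv_cancel:
  assumes "g \<in> carrier G" "h \<in> carrier G"
  shows "h \<otimes> (inv h \<otimes> g) = g" "inv h \<otimes> (h \<otimes> g) = g"
  using assms m_assoc[of h "inv h" g] m_assoc[of "inv h" h g] by simp_all

text \<open>An explicit description of the generated equivalence, confirmed in
  \<open>cls_eq_iff\<close>. Over G the second component is transported by \<alpha>. A letter [0,x]
  with x in dom \<alpha>_0 is determined by the value \<alpha>_0(x), while outside dom \<alpha>_0
  the letters [0,x] correspond to orbits of the partial action of G.\<close>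

fun tensor_eq :: "'g option \<times> 'x \<Rightarrow> 'g option \<times> 'x \<Rightarrow> bool" where
  "tensor_eq (Some g, x) (Some h, y) \<longleftrightarrow> x \<in> D (Some (inv h \<otimes> g)) \<and> y = \<alpha> (Some (inv h \<otimes> g)) x"
| "tensor_eq (Some g, x) (None, y) \<longleftrightarrow> y \<in> D None \<and> x = \<alpha> None y"
| "tensor_eq (None, x) (Some h, y) \<longleftrightarrow> x \<in> D None \<and> y = \<alpha> None x"
| "tensor_eq (None, x) (None, y) \<longleftrightarrow>
     (if x \<in> D None then y \<in> D None \<and> \<alpha> None x = \<alpha> None y
      else \<exists>g\<in>carrier G. x \<in> D (Some g) \<and> y = \<alpha> (Some g) x)"

lemma tensor_eq_refl: "p \<in> carrier M \<times> carrier X \<Longrightarrow> tensor_eq p p"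
  by (cases p; cases "fst p") (auto intro!: bexI[of _ \<one>])

lemma tensor_eq_sym:
  assumes "p \<in> carrier M \<times> carrier X" "q \<in> carrier M \<times> carrier X" "tensor_eq p q"
  shows "tensor_eq q p"
proof -
  obtain m x n y where p: "p = (m, x)" and q: "q = (n, y)"
    by (metis surj_pair)
  note eq = assms(3)[unfolded p q]
  have mem: "m \<in> carrier M" "n \<in> carrier M"
    using assms(1,2) p q by auto
  have "tensor_eq (n, y) (m, x)"
  proof (cases m; cases n)
    fix g h assume m: "m = Some g" and n: "n = Some h"
    then have "inv (inv h \<otimes> g) = inv g \<otimes> h"
      using mem by (simp add: inv_mult_group)
    with act_inv[of "inv h \<otimes> g" x] eq m n mem show ?thesis by simp
  next
    assume m: "m = None" and n: "n = None"
    show ?thesis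
    proof (cases "x \<in> D None")
      case True
      with eq m n show ?thesis by simp
    next
      case False
      with eq m n obtain g where "g \<in> carrier G" "x \<in> D (Some g)" "y = \<alpha> (Some g) x"
        by auto
      with False act_inv[of g x] act_in_dom_zero[of "Some g" x] m n show ?thesis
        by (auto intro!: bexI[of _ "inv g"])
    qed
  qed (use eq in simp_all)
  then show ?thesis by (simp add: p q)
qed

text \<open>Split on the middle component. Passing through 0 produces values of \<alpha>_0, which
  \<open>act_zero\<close> shows to be fixed points; otherwise two maps indexed by G are
  composed.\<close>

lemma tensor_eq_trans:
  assumes "p \<in> carrier M \<times> carrier X" "q \<in> carrier M \<times> carrier X" "r \<in> carrier M \<times> carrier X"
    and pq: "tensor_eq p q" and qr: "tensor_eq q r"
  shows "tensor_eq p r"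
proof -
  obtain m x n y k z where p: "p = (m, x)" and q: "q = (n, y)" and r: "r = (k, z)"
    by (metis surj_pair)
  have mem: "m \<in> carrier M" "n \<in> carrier M" "k \<in> carrier M"
    "x \<in> carrier X" "y \<in> carrier X" "z \<in> carrier X"
    using assms p q r by auto
  note eqs = pq[unfolded p q] qr[unfolded q r]
  \<comment> \<open>The reversed relation serves the case of m in G and k = 0: it expresses x as the
    image of y, and y = \<alpha>_0(z) is fixed.\<close>
  have qp: "tensor_eq (n, y) (m, x)"
    using tensor_eq_sym[OF assms(1,2) pq] p q by simp
  have "tensor_eq (m, x) (k, z)"
  proof (cases n)
    case None
    show ?thesis
    proof (cases m; cases k)
      fix g h assume "m = Some g" "k = Some h"
      with eqs None mem act_zero[of "Some (inv h \<otimes> g)" y] show ?thesis by simp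
    next
      fix g assume "m = None" "k = Some g"
      with eqs None mem act_in_dom_zero[of "Some _" x] zero_act[of "Some _" x] show ?thesis
        by (auto split: if_splits)
    next
      assume "m = None" "k = None"
      show ?thesis
      proof (cases "x \<in> D None")
        case True
        with eqs \<open>m = None\<close> \<open>k = None\<close> \<open>n = None\<close> show ?thesis by simp
      next
        case False
        with eqs \<open>m = None\<close> \<open>k = None\<close> \<open>n = None\<close>
        obtain g where g: "g \<in> carrier G" "x \<in> D (Some g)" "y = \<alpha> (Some g) x"
          by auto
        \<comment> \<open>Leaving dom \<alpha>_0 is impossible along an orbit in either direction,
          so the second relation is again of orbit type and the two group elements multiply.\<close>
        with False act_in_dom_zero have "y \<notin> D None" by simp
        with eqs \<open>k = None\<close> \<open>n = None\<close>
        obtain h where h: "h \<in> carrier G" "y \<in> D (Some h)" "z = \<alpha> (Some h) y"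
          by auto
        with g dom_mult_iff[of "Some g" "Some h" x] act_mult[of "Some g" "Some h" x]
        have "x \<in> D (Some (h \<otimes> g))" "z = \<alpha> (Some (h \<otimes> g)) x"
          by simp_all
        with False g h \<open>m = None\<close> \<open>k = None\<close> show ?thesis
          by auto
      qed
    qed (use eqs None in simp_all)
  next
    case (Some h)
    show ?thesis
    proof (cases m; cases k)
      fix g l assume "m = Some g" "k = Some l"
      moreover have "inv l \<otimes> h \<otimes> (inv h \<otimes> g) = inv l \<otimes> g"
        if "g \<in> carrier G" "l \<in> carrier G" "h \<in> carrier G"
        using that by (metis inv_closed l_one m_assoc m_closed r_inv)
      ultimately show ?thesis
        using eqs Some mem dom_mult_iff[of "Some (inv h \<otimes> g)" "Some (inv l \<otimes> h)" x]
          act_mult[of "Some (inv h \<otimes> g)" "Some (inv l \<otimes> h)" x] by simp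
    next
      fix g assume "m = Some g" "k = None"
      with eqs qp Some mem act_zero[of "Some (inv g \<otimes> h)" z] show ?thesis by simp
    next
      fix l assume "m = None" "k = Some l"
      with eqs Some mem act_zero[of "Some (inv l \<otimes> h)" x] show ?thesis by simp
    qed (use eqs Some in simp_all)
  qed
  then show ?thesis by (simp add: p r)
qed

lemma tensor_step_imp_eq: "tensor_step M X D \<alpha> p q \<Longrightarrow> tensor_eq p q"
proof -
  assume "tensor_step M X D \<alpha> p q"
  then obtain m n x k where *: "p = (m, x)" "q = (n, \<alpha> k x)" "m = n \<otimes>\<^bsub>M\<^esub> k" "k \<in> carrier M"
    "x \<in> D k" "m \<in> carrier M" "n \<in> carrier M"
    by (cases p; cases q) (auto simp: tensor_step_def)
  show ?thesis
  proof (cases n; cases k)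
    fix h g assume "n = Some h" "k = Some g"
    then show ?thesis using * by (simp add: mult_inv_cancel)
  next
    fix g assume "n = None" "k = Some g"
    then show ?thesis using * act_in_dom_zero[of k x] zero_act[of k x] by auto
  qed (use * act_zero[of None x] in simp_all)
qed

lemma tensor_step_in: "tensor_step M X D \<alpha> p q \<Longrightarrow> (p, q) \<in> tensor_rel M X D \<alpha>"
  by (auto simp: tensor_rel_def tensor_step_def intro!: r_into_equivclp)

section \<open>Identities between letters and the criterion for their equality\<close>

lemma cls_act:
  assumes "m \<in> carrier M" "n \<in> carrier M" "x \<in> D m"
  shows "cls (n \<otimes>\<^bsub>M\<^esub> m) x = cls n (\<alpha> m x)"
  unfolding tensor_class_def
  by (rule equiv_class_eq[OF equiv_tensor_rel], rule tensor_step_in)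
    (use assms A.m_closed[of n m] dom_carrier[of x m] act_carrier[of x m] in
      \<open>auto simp: tensor_step_def\<close>)

lemma cls_act_group:
  assumes "g \<in> carrier G" "h \<in> carrier G" "x \<in> D (Some (inv h \<otimes> g))"
  shows "cls (Some h) (\<alpha> (Some (inv h \<otimes> g)) x) = cls (Some g) x"
  using cls_act[of "Some (inv h \<otimes> g)" "Some h" x] assms by (simp add: mult_inv_cancel)

lemma cls_zero_act: "\<lbrakk>m \<in> carrier M; x \<in> D m\<rbrakk> \<Longrightarrow> cls None (\<alpha> m x) = cls None x"
  using cls_act[of m None x] by simp

lemma cls_act_zero: "\<lbrakk>m \<in> carrier M; x \<in> D None\<rbrakk> \<Longrightarrow> cls m (\<alpha> None x) = cls None x"
  using cls_act[of None m x] by simp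

text \<open>\<open>tensor_eq\<close> is an equivalence on M \<times> X that contains the generating
  steps, hence it contains the generated equivalence. Conversely, each of its clauses follows from
  instances of \<open>cls_act\<close>.\<close>

lemma cls_eq_iff:
  assumes "m \<in> carrier M" "n \<in> carrier M" "x \<in> carrier X" "y \<in> carrier X"
  shows "cls m x = cls n y \<longleftrightarrow> tensor_eq (m, x) (n, y)"
proof
  assume "cls m x = cls n y"
  then have "((m, x), (n, y)) \<in> tensor_rel M X D \<alpha>"
    unfolding tensor_class_def using assms by (intro eq_equiv_class[OF _ equiv_tensor_rel]) auto
  then have "equivclp (tensor_step M X D \<alpha>) (m, x) (n, y)"
    by (simp add: tensor_rel_def)
  \<comment> \<open>Membership in the carrier is carried through the induction because transitivity
    of \<open>tensor_eq\<close> is available only there.\<close>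
  then have "tensor_eq (m, x) (n, y) \<and> (n, y) \<in> carrier M \<times> carrier X"
  proof (induction rule: equivclp_induct)
    case base
    show ?case using assms tensor_eq_refl by simp
  next
    case (step q r)
    then have "q \<in> carrier M \<times> carrier X" "r \<in> carrier M \<times> carrier X"
      by (auto simp: tensor_step_def)
    moreover from step(2) have "tensor_eq q r \<or> tensor_eq r q"
      using tensor_step_imp_eq by blast
    ultimately have "tensor_eq q r" "r \<in> carrier M \<times> carrier X"
      using tensor_eq_sym by blast+
    with step tensor_eq_trans[of "(m, x)" q r] assms show ?case by simp
  qed
  then show "tensor_eq (m, x) (n, y)" ..
next
  assume *: "tensor_eq (m, x) (n, y)"
  show "cls m x = cls n y"
  proof (cases m; cases n)
    fix g h assume "m = Some g" "n = Some h"
    with * assms cls_act_group[of g h x] show ?thesis by simp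
  next
    assume mn: "m = None" "n = None"
    show ?thesis
    proof (cases "x \<in> D None")
      case True
      with * mn have "y \<in> D None" "\<alpha> None x = \<alpha> None y"
        by simp_all
      with True mn show ?thesis
        using cls_zero_act[of None x] cls_zero_act[of None y] by (metis carrier_M(1))
    next
      case False
      with * mn obtain g where "g \<in> carrier G" "x \<in> D (Some g)" "y = \<alpha> (Some g) x"
        by auto
      with mn show ?thesis
        using cls_zero_act[of "Some g" x] by simp
    qed
  qed (use * assms cls_act_zero[of m y] cls_act_zero[of n x] in simp_all)
qed

text \<open>Brings both forms of equality over 0 into one shape, a common image. The witnesses are
  \<open>None\<close> on both sides inside dom \<alpha>_0, and g with the identity outside
  it.\<close>

lemma cls_zero_eqE:
  assumes "cls None x = cls None y" "x \<in> carrier X" "y \<in> carrier X"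
  obtains k l where "k \<in> carrier M" "l \<in> carrier M" "x \<in> D k" "y \<in> D l" "\<alpha> k x = \<alpha> l y"
proof (cases "x \<in> D None")
  case True
  with assms that[of None None] show ?thesis by (simp add: cls_eq_iff)
next
  case False
  with assms obtain g where "g \<in> carrier G" "x \<in> D (Some g)" "y = \<alpha> (Some g) x"
    by (auto simp: cls_eq_iff)
  with assms(3) show ?thesis
    by (intro that[of "Some g" "Some \<one>"]) simp_all
qed

section \<open>Products of classes\<close>

text \<open>The link between the two sides of the theorem: it is equivalent to uniqueness of
  contracta (\<open>contract_deterministic_iff\<close>) and to (LC2) with (LC3)
  (\<open>zero_congruence_iff\<close>).\<close>

definition zero_congruence :: bool where
  "zero_congruence \<longleftrightarrow> (\<forall>x\<in>carrier X. \<forall>x'\<in>carrier X. \<forall>y\<in>carrier X. \<forall>y'\<in>carrier X.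
     cls None x = cls None x' \<and> cls None y = cls None y' \<longrightarrow> cls None (x \<cdot> y) = cls None (x' \<cdot> y'))"

lemma zero_congruenceD:
  "\<lbrakk>zero_congruence; cls None x = cls None x'; cls None y = cls None y';
    x \<in> carrier X; x' \<in> carrier X; y \<in> carrier X; y' \<in> carrier X\<rbrakk>
   \<Longrightarrow> cls None (x \<cdot> y) = cls None (x' \<cdot> y')"
  unfolding zero_congruence_def by blast

lemma carrier_adjoin_one [simp]:
  "None \<in> carrier (adjoin_one X)" "Some a \<in> carrier (adjoin_one X) \<longleftrightarrow> a \<in> carrier X"
  by (auto simp: adjoin_one_def)

lemma prod1_simps [simp]:
  "prod1 X None y None = y"
  "prod1 X (Some a) y None = a \<cdot> y"
  "prod1 X None y (Some b) = y \<cdot> b"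
  "prod1 X (Some a) y (Some b) = a \<cdot> y \<cdot> b"
  by (simp_all add: prod1_def adjoin_one_def)

lemma prod1_closed:
  "\<lbrakk>x \<in> carrier (adjoin_one X); y \<in> carrier X; z \<in> carrier (adjoin_one X)\<rbrakk> \<Longrightarrow> prod1 X x y z \<in> carrier X"
  by (cases x; cases z) (auto simp: X.m_closed)

lemma zero_congruence_prod1:
  assumes "zero_congruence" "cls None y = cls None y'" "y \<in> carrier X" "y' \<in> carrier X"
    "x \<in> carrier (adjoin_one X)" "z \<in> carrier (adjoin_one X)"
  shows "cls None (prod1 X x y z) = cls None (prod1 X x y' z)"
proof -
  let ?u = "prod1 X x y None" and ?u' = "prod1 X x y' None"
  have closed: "?u \<in> carrier X" "?u' \<in> carrier X"
    using assms prod1_closed by simp_all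
  have u: "cls None ?u = cls None ?u'"
  proof (cases x)
    case (Some a)
    with zero_congruenceD[OF assms(1) refl assms(2), of a] assms show ?thesis by simp
  qed (use assms in simp)
  show ?thesis
  proof (cases z)
    case (Some b)
    have "prod1 X x v z = prod1 X x v None \<cdot> b" for v
      using Some by (cases x) simp_all
    moreover have "cls None (?u \<cdot> b) = cls None (?u' \<cdot> b)"
      using zero_congruenceD[OF assms(1) u refl closed] Some assms by simp
    ultimately show ?thesis by simp
  qed (use u in simp)
qed

text \<open>Since [0,\<alpha>_m(y)] = [0,y], a congruence lets factors be replaced by their images;
  reading the resulting equality through \<open>cls_eq_iff\<close> gives (LC2) inside dom \<alpha>_0
  and (LC3) outside. Conversely, by \<open>cls_zero_eqE\<close> it is enough to replace each factor
  by an image.\<close>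

lemma zero_congruence_iff:
  "zero_congruence \<longleftrightarrow>
    (\<forall>m\<in>carrier M. \<forall>y\<in>D m. \<forall>x\<in>carrier (adjoin_one X). \<forall>z\<in>carrier (adjoin_one X).
       prod1 X x y z \<in> D None \<longrightarrow>
         prod1 X x (\<alpha> m y) z \<in> D None \<and>
         \<alpha> None (prod1 X x y z) = \<alpha> None (prod1 X x (\<alpha> m y) z))
    \<and> (\<forall>g\<in>carrier G. \<forall>h\<in>carrier G. \<forall>x\<in>D (Some g). \<forall>y\<in>D (Some h).
       \<forall>z\<in>carrier (adjoin_one X).
         prod1 X (Some x) y z \<notin> D None \<longrightarrow>
           (\<exists>k\<in>carrier G. prod1 X (Some x) y z \<in> D (Some k) \<and>
             \<alpha> (Some k) (prod1 X (Some x) y z)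
               = prod1 X (Some (\<alpha> (Some g) x)) (\<alpha> (Some h) y) z))"
    (is "_ \<longleftrightarrow> ?LC2 \<and> ?LC3")
proof
  assume cong: zero_congruence
  have ?LC2
  proof (intro ballI impI)
    fix m y x z
    assume m: "m \<in> carrier M" "y \<in> D m" and xz: "x \<in> carrier (adjoin_one X)" "z \<in> carrier (adjoin_one X)"
      and zero: "prod1 X x y z \<in> D None"
    have y: "y \<in> carrier X" "\<alpha> m y \<in> carrier X"
      using m dom_carrier act_carrier by auto
    have "cls None (prod1 X x y z) = cls None (prod1 X x (\<alpha> m y) z)"
      using zero_congruence_prod1[OF cong _ y xz] cls_zero_act[OF m] by simp
    with zero y xz show "prod1 X x (\<alpha> m y) z \<in> D None \<and>
        \<alpha> None (prod1 X x y z) = \<alpha> None (prod1 X x (\<alpha> m y) z)"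
      by (simp add: cls_eq_iff prod1_closed)
  qed
  moreover have ?LC3
  proof (intro ballI impI)
    fix g h x y z
    assume g: "g \<in> carrier G" "x \<in> D (Some g)" and h: "h \<in> carrier G" "y \<in> D (Some h)"
      and z: "z \<in> carrier (adjoin_one X)" and nonzero: "prod1 X (Some x) y z \<notin> D None"
    have xy: "x \<in> carrier X" "\<alpha> (Some g) x \<in> carrier X" "y \<in> carrier X" "\<alpha> (Some h) y \<in> carrier X"
      using g h dom_carrier[of _ "Some _"] act_carrier[of _ "Some _"] by auto
    have "cls None (x \<cdot> y) = cls None (\<alpha> (Some g) x \<cdot> \<alpha> (Some h) y)"
      using zero_congruenceD[OF cong _ _ xy] cls_zero_act[of "Some g" x] cls_zero_act[of "Some h" y]
        g h by simp
    \<comment> \<open>The product xy is taken as the middle element, with the adjoined identity on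
      its left.\<close>
    from zero_congruence_prod1[OF cong this, of None z] xy z
    have "cls None (prod1 X (Some x) y z) = cls None (prod1 X (Some (\<alpha> (Some g) x)) (\<alpha> (Some h) y) z)"
      by (cases z) (simp_all add: X.m_closed)
    with nonzero xy z show "\<exists>k\<in>carrier G. prod1 X (Some x) y z \<in> D (Some k) \<and>
        \<alpha> (Some k) (prod1 X (Some x) y z) = prod1 X (Some (\<alpha> (Some g) x)) (\<alpha> (Some h) y) z"
      by (auto simp: cls_eq_iff prod1_closed)
  qed
  ultimately show "?LC2 \<and> ?LC3" ..
next
  assume LC: "?LC2 \<and> ?LC3"
  have LC2: "prod1 X x (\<alpha> m y) z \<in> D None \<and> \<alpha> None (prod1 X x y z) = \<alpha> None (prod1 X x (\<alpha> m y) z)"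
    if "m \<in> carrier M" "y \<in> D m" "x \<in> carrier (adjoin_one X)" "z \<in> carrier (adjoin_one X)"
      "prod1 X x y z \<in> D None" for m x y z
    using LC that by blast
  have prod: "cls None (x \<cdot> y) = cls None (\<alpha> k x \<cdot> \<alpha> l y)"
    if k: "k \<in> carrier M" "x \<in> D k" and l: "l \<in> carrier M" "y \<in> D l" for k l x y
  proof -
    have xy: "x \<in> carrier X" "\<alpha> k x \<in> carrier X" "y \<in> carrier X" "\<alpha> l y \<in> carrier X"
      using k l dom_carrier act_carrier by auto
    show ?thesis
    proof (cases "x \<cdot> y \<in> D None")
      case True
      \<comment> \<open>Two applications of (LC2): first x becomes \<alpha>_k(x) beside y, then y
        becomes \<alpha>_l(y) beside \<alpha>_k(x).\<close>
      then show ?thesis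
        using LC2[of k x None "Some y"] LC2[of l y "Some (\<alpha> k x)" None] k l xy
        by (simp add: cls_eq_iff X.m_closed)
    next
      case False
      with k l xy dom_prod[of None x y] dom_prod[of None y x]
      obtain g h where gh: "k = Some g" "g \<in> carrier G" "l = Some h" "h \<in> carrier G"
        by (cases k; cases l) auto
      have "\<exists>j\<in>carrier G. prod1 X (Some x) y None \<in> D (Some j) \<and>
          \<alpha> (Some j) (prod1 X (Some x) y None) = prod1 X (Some (\<alpha> (Some g) x)) (\<alpha> (Some h) y) None"
        using LC gh k l False by (metis carrier_adjoin_one(1) prod1_simps(2))
      with False xy gh show ?thesis
        by (auto simp: cls_eq_iff X.m_closed)
    qed
  qed
  show zero_congruence
    unfolding zero_congruence_def
  proof (intro ballI impI, elim conjE)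
    fix x x' y y'
    assume *: "x \<in> carrier X" "x' \<in> carrier X" "y \<in> carrier X" "y' \<in> carrier X"
    assume x: "cls None x = cls None x'" and y: "cls None y = cls None y'"
    from cls_zero_eqE[OF x *(1,2)] obtain k k' where
      "k \<in> carrier M" "k' \<in> carrier M" "x \<in> D k" "x' \<in> D k'" "\<alpha> k x = \<alpha> k' x'" .
    moreover from cls_zero_eqE[OF y *(3,4)] obtain l l' where
      "l \<in> carrier M" "l' \<in> carrier M" "y \<in> D l" "y' \<in> D l'" "\<alpha> l y = \<alpha> l' y'" .
    ultimately show "cls None (x \<cdot> y) = cls None (x' \<cdot> y')"
      using prod[of k x l y] prod[of k' x' l' y'] by simp
  qed
qed

section \<open>Contractions of letters of X_M: uniqueness and overlaps\<close>

definition contract where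
  "contract a b c \<longleftrightarrow> (\<exists>m\<in>carrier M. \<exists>x\<in>carrier X. \<exists>y\<in>carrier X.
     a = cls m x \<and> b = cls m y \<and> c = cls m (x \<cdot> y))"

lemma rewrite_step_eq: "rewrite_step M X D \<alpha> = contraction_step (tensor_set M X D \<alpha>) contract"
  unfolding fun_eq_iff rewrite_step_def contraction_step_def contract_def by blast

lemma cls_in: "\<lbrakk>m \<in> carrier M; x \<in> carrier X\<rbrakk> \<Longrightarrow> cls m x \<in> tensor_set M X D \<alpha>"
  by (auto simp: tensor_set_def tensor_class_def intro!: quotientI)

lemma contract_in:
  "contract a b c \<Longrightarrow> a \<in> tensor_set M X D \<alpha> \<and> b \<in> tensor_set M X D \<alpha> \<and> c \<in> tensor_set M X D \<alpha>"
  by (auto simp: contract_def cls_in X.m_closed)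

lemma contractI:
  "\<lbrakk>m \<in> carrier M; x \<in> carrier X; y \<in> carrier X\<rbrakk> \<Longrightarrow> contract (cls m x) (cls m y) (cls m (x \<cdot> y))"
  unfolding contract_def by blast

text \<open>Another representation of the pair over h in G arises by applying a single homomorphism
  to x and y, so it also carries xy to the new product. For a representation over 0, x and y are the
  values of \<alpha>_0 at x' and y', and hence xy = \<alpha>_0(x'y').\<close>

lemma contract_group:
  assumes "contract (cls (Some g) x) (cls (Some g) y) c"
    and g: "g \<in> carrier G" and xy: "x \<in> carrier X" "y \<in> carrier X"
  shows "c = cls (Some g) (x \<cdot> y)"
proof -
  from assms obtain m x' y' where *: "m \<in> carrier M" "x' \<in> carrier X" "y' \<in> carrier X"
    "cls (Some g) x = cls m x'" "cls (Some g) y = cls m y'" "c = cls m (x' \<cdot> y')"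
    unfolding contract_def by blast
  have "tensor_eq (Some g, x) (m, x')" "tensor_eq (Some g, y) (m, y')"
    using * g xy by (simp_all flip: cls_eq_iff)
  then have "tensor_eq (Some g, x \<cdot> y) (m, x' \<cdot> y')"
    using * g xy by (cases m) (simp_all add: act_prod dom_prod)
  with * g xy have "cls (Some g) (x \<cdot> y) = cls m (x' \<cdot> y')"
    by (simp add: cls_eq_iff X.m_closed)
  with * show ?thesis by simp
qed

text \<open>Contractions over 0 give the congruence. In return, if one of two representations of a
  pair is over G then \<open>contract_group\<close> identifies the contracta; if both are over 0,
  the congruence does.\<close>

lemma contract_deterministic_iff:
  "(\<forall>a b c c'. contract a b c \<and> contract a b c' \<longrightarrow> c = c') \<longleftrightarrow> zero_congruence"
proof
  assume det: "\<forall>a b c c'. contract a b c \<and> contract a b c' \<longrightarrow> c = c'"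
  show zero_congruence
    unfolding zero_congruence_def
    using det contractI[of None] by (metis carrier_M(1))
next
  assume cong: zero_congruence
  show "\<forall>a b c c'. contract a b c \<and> contract a b c' \<longrightarrow> c = c'"
  proof (intro allI impI)
    fix a b c c' assume con: "contract a b c \<and> contract a b c'"
    then obtain m x y n x' y' where *:
      "m \<in> carrier M" "x \<in> carrier X" "y \<in> carrier X" "n \<in> carrier M" "x' \<in> carrier X" "y' \<in> carrier X"
      "a = cls m x" "b = cls m y" "c = cls m (x \<cdot> y)" "a = cls n x'" "b = cls n y'" "c' = cls n (x' \<cdot> y')"
      unfolding contract_def by blast
    show "c = c'"
    proof (cases m)
      case None
      show ?thesis
      proof (cases n)
        case (Some h)
        with con * contract_group[of h x' y' c] show ?thesis by simp
      qed (use None * cong zero_congruenceD in metis)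
    next
      case (Some g)
      with con * contract_group[of g x y c'] show ?thesis by simp
    qed
  qed
qed

text \<open>Tests the word [g,x][g,y][e,z], whose middle letter is also [e,\<alpha>_g(y)]. A common
  contractum of the two reducts is computed once over e and once over g; comparing second components
  over g gives the equation.\<close>

lemma overlap_imp_LC1:
  assumes overlap: "\<And>a b c d f. contract a b d \<Longrightarrow> contract b c f \<Longrightarrow>
      d = a \<and> c = f \<or> (\<exists>s. contract d c s \<and> contract a f s)"
    and g: "g \<in> carrier G" and xyz: "x \<in> carrier X" "y \<in> carrier X" "z \<in> carrier X"
    and dom: "y \<in> D (Some g)"
  shows "\<alpha> (Some (inv g)) (\<alpha> (Some g) (x \<cdot> y) \<cdot> z) = x \<cdot> \<alpha> (Some (inv g)) (\<alpha> (Some g) y \<cdot> z)"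
proof -
  let ?y = "\<alpha> (Some g) y" and ?xy = "\<alpha> (Some g) (x \<cdot> y)"
  \<comment> \<open>\<alpha>_g maps into dom \<alpha> of the inverse, which is an ideal and thus
    absorbs z.\<close>
  have inv_dom: "?y \<cdot> z \<in> D (Some (inv g))" "?xy \<cdot> z \<in> D (Some (inv g))"
    using act_inv(1) dom_prod(1) g dom dom_prod(2) xyz by simp_all
  have mem: "?y \<in> carrier X" "?xy \<in> carrier X" "x \<cdot> y \<in> D (Some g)" "x \<cdot> y \<in> carrier X"
    using act_carrier dom_prod(2) g dom xyz X.m_closed by simp_all
  let ?w = "\<alpha> (Some (inv g)) (?y \<cdot> z)"
  have w: "?w \<in> carrier X"
    using act_carrier inv_dom g by simp
  have y_eq: "cls (Some \<one>) ?y = cls (Some g) y"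
    using cls_act_group[of g \<one> y] g dom by simp
  have xy_eq: "cls (Some g) (x \<cdot> y) = cls (Some \<one>) ?xy"
    using cls_act_group[of g \<one> "x \<cdot> y"] g mem by simp
  have w_eq: "cls (Some \<one>) (?y \<cdot> z) = cls (Some g) ?w"
    using cls_act_group[of \<one> g "?y \<cdot> z"] g inv_dom by simp
  have xyz_eq: "cls (Some \<one>) (?xy \<cdot> z) = cls (Some g) (\<alpha> (Some (inv g)) (?xy \<cdot> z))"
    using cls_act_group[of \<one> g "?xy \<cdot> z"] g inv_dom by simp
  have "contract (cls (Some g) x) (cls (Some g) y) (cls (Some g) (x \<cdot> y))"
    "contract (cls (Some g) y) (cls (Some \<one>) z) (cls (Some \<one>) (?y \<cdot> z))"
    using contractI[of "Some g" x y] contractI[of "Some \<one>" ?y z, unfolded y_eq] g xyz mem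
    by simp_all
  from overlap[OF this] consider
    "cls (Some g) (x \<cdot> y) = cls (Some g) x" "cls (Some \<one>) z = cls (Some \<one>) (?y \<cdot> z)"
    | s where "contract (cls (Some g) (x \<cdot> y)) (cls (Some \<one>) z) s"
      "contract (cls (Some g) x) (cls (Some \<one>) (?y \<cdot> z)) s"
    by blast
  then show ?thesis
  proof cases
    case 1
    \<comment> \<open>If the reducts are already equal, x = xy lies in dom \<alpha>_g and z lies in
      the domain of the inverse map. The homomorphism property then splits the left side into x
      times the image of z.\<close>
    then have "x \<cdot> y = x" "?y \<cdot> z = z"
      using g xyz mem by (simp_all add: cls_eq_iff X.m_closed)
    then show ?thesis
      using g mem inv_dom act_inv[of g x] by (simp add: act_prod)
  next
    case (2 s)
    have "s = cls (Some \<one>) (?xy \<cdot> z)"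
      using contract_group[OF 2(1)[unfolded xy_eq]] mem xyz by simp
    moreover have "s = cls (Some g) (x \<cdot> ?w)"
      using contract_group[OF 2(2)[unfolded w_eq]] g xyz w by simp
    ultimately have "cls (Some g) (\<alpha> (Some (inv g)) (?xy \<cdot> z)) = cls (Some g) (x \<cdot> ?w)"
      by (simp add: xyz_eq)
    with g xyz mem w inv_dom act_carrier[of "?xy \<cdot> z" "Some (inv g)"] show ?thesis
      by (simp add: cls_eq_iff X.m_closed)
  qed
qed

text \<open>For x = \<alpha>_0(w), both letters equal [0,w]; this is how the component in M is
  changed freely on im \<alpha>_0.\<close>

lemma cls_zero_im:
  assumes "m \<in> carrier M" "x \<in> \<alpha> None ` D None"
  shows "cls m x = cls None x"
proof -
  from assms(2) obtain w where w: "w \<in> D None" "x = \<alpha> None w" by blast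
  show ?thesis
    unfolding w(2) cls_act_zero[OF assms(1) w(1)] cls_act_zero[OF carrier_M(1) w(1)] ..
qed

lemma im_zero_prod:
  assumes "x \<in> \<alpha> None ` D None" "y \<in> carrier X"
  shows "x \<cdot> y \<in> \<alpha> None ` D None" "y \<cdot> x \<in> \<alpha> None ` D None"
  using im_ideal[OF carrier_M(1)] assms unfolding semigroup_ideal_def by blast+

text \<open>The contractum d is rewritten over n, the component of c, and f over m, the component of
  a. Both neighbours can then be contracted, and it remains to compare the two results.\<close>

lemma overlap_resolves:
  assumes cong: zero_congruence
    and LC1: "\<And>g x y z. \<lbrakk>g \<in> carrier G; x \<in> carrier X; y \<in> carrier X; z \<in> carrier X; y \<in> D (Some g)\<rbrakk>
      \<Longrightarrow> \<alpha> (Some (inv g)) (\<alpha> (Some g) (x \<cdot> y) \<cdot> z) = x \<cdot> \<alpha> (Some (inv g)) (\<alpha> (Some g) y \<cdot> z)"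
    and con: "contract a b d" "contract b c f"
  shows "\<exists>s. contract d c s \<and> contract a f s"
proof -
  obtain m x y n y' z where mn: "m \<in> carrier M" "n \<in> carrier M"
    and X: "x \<in> carrier X" "y \<in> carrier X" "y' \<in> carrier X" "z \<in> carrier X"
    and a: "a = cls m x" and c: "c = cls n z" and d: "d = cls m (x \<cdot> y)" and f: "f = cls n (y' \<cdot> z)"
    and b: "b = cls m y" "b = cls n y'"
    using con unfolding contract_def by blast
  have eq: "tensor_eq (m, y) (n, y')"
    using b cls_eq_iff[OF mn X(2,3)] by simp
  \<comment> \<open>Associativity transported through the congruence; it compares the final letters
    whenever 0 occurs among m and n.\<close>
  have zero: "cls None (x \<cdot> y \<cdot> z) = cls None (x \<cdot> (y' \<cdot> z))"
    if "cls None y = cls None y'"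
  proof -
    have "cls None (y \<cdot> z) = cls None (y' \<cdot> z)"
      using zero_congruenceD[OF cong that refl] X by blast
    from zero_congruenceD[OF cong refl this, of x] X show ?thesis
      by (simp add: X.m_assoc X.m_closed)
  qed
  have resolve: ?thesis if "k \<in> carrier M" "l \<in> carrier M" "u \<in> carrier X" "w \<in> carrier X"
    "d = cls k u" "c = cls k z" "a = cls l x" "f = cls l w" "cls k (u \<cdot> z) = cls l (x \<cdot> w)" for k l u w
    using contractI[of k u z] contractI[of l x w] that X by metis
  show ?thesis
  proof (cases m; cases n)
    assume "m = None" "n = None"
    with a c d f b zero X show ?thesis
      by (intro resolve[of None None "x \<cdot> y" "y' \<cdot> z"]) (simp_all add: X.m_closed)
  next
    fix g assume m: "m = Some g" and n: "n = None"
    have y: "y' \<in> D None" "y = \<alpha> None y'" using eq m n by simp_all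
    let ?w = "\<alpha> None (y' \<cdot> z)"
    \<comment> \<open>Here y is in im \<alpha>_0 and y' in dom \<alpha>_0. The first ideal lets d =
      [g,xy] be read over 0, the second lets f = [0,y'z] be read over g with second component
      \<open>?w\<close>.\<close>
    have yz: "y' \<cdot> z \<in> D None"
      using dom_prod(1)[of None] y(1) X by simp
    have w: "?w \<in> carrier X" "cls None ?w = cls None (y' \<cdot> z)"
      using act_carrier[of _ None] cls_zero_act[of None] yz by simp_all
    have "cls None y = cls None y'"
      unfolding y(2) using cls_zero_act[of None] y(1) by simp
    note xyz = zero[OF this]
    have "cls None (x \<cdot> ?w) = cls None (x \<cdot> (y' \<cdot> z))"
      using zero_congruenceD[OF cong refl w(2)] w(1) X by (simp add: X.m_closed)
    moreover have "cls m (x \<cdot> ?w) = cls None (x \<cdot> ?w)"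
      using cls_zero_im[OF mn(1)] im_zero_prod(2) yz X(1) by blast
    moreover have "d = cls None (x \<cdot> y)"
      unfolding d using cls_zero_im[OF mn(1)] im_zero_prod(2) y X(1) by blast
    moreover have "f = cls m ?w"
      unfolding f n using cls_act_zero[OF mn(1) yz] by simp
    ultimately show ?thesis
      using xyz a c n mn w X by (intro resolve[of None m "x \<cdot> y" ?w]) (simp_all add: X.m_closed)
  next
    fix h assume m: "m = None" and n: "n = Some h"
    have y: "y \<in> D None" "y' = \<alpha> None y" using eq m n by simp_all
    let ?u = "\<alpha> None (x \<cdot> y)"
    \<comment> \<open>The mirror image: d moves from 0 to h by applying \<alpha>_0, and f moves from
      h to 0 because y'z lies in im \<alpha>_0.\<close>
    have xy: "x \<cdot> y \<in> D None"
      using dom_prod(2)[of None] y(1) X by simp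
    have u: "?u \<in> carrier X" "cls None ?u = cls None (x \<cdot> y)"
      using act_carrier[of _ None] cls_zero_act[of None] xy by simp_all
    have "cls None y = cls None y'"
      unfolding y(2) using cls_zero_act[of None] y(1) by simp
    note xyz = zero[OF this]
    have "cls None (?u \<cdot> z) = cls None (x \<cdot> y \<cdot> z)"
      using zero_congruenceD[OF cong u(2) refl] u(1) X by (simp add: X.m_closed)
    moreover have "cls n (?u \<cdot> z) = cls None (?u \<cdot> z)"
      using cls_zero_im[OF mn(2)] im_zero_prod(1) xy X(4) by blast
    moreover have "f = cls None (y' \<cdot> z)"
      unfolding f using cls_zero_im[OF mn(2)] im_zero_prod(1) y X(4) by blast
    moreover have "d = cls n ?u"
      unfolding d m using cls_act_zero[OF mn(2) xy] by simp
    ultimately show ?thesis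
      using xyz a c m mn u X by (intro resolve[of n None ?u "y' \<cdot> z"]) (simp_all add: X.m_closed)
  next
    fix g h assume m: "m = Some g" and n: "n = Some h"
    let ?k = "inv h \<otimes> g"
    have gh: "g \<in> carrier G" "h \<in> carrier G"
      using mn m n by simp_all
    then have k: "?k \<in> carrier G" and inv_k: "inv ?k = inv g \<otimes> h"
      by (simp_all add: inv_mult_group)
    have y: "y \<in> D (Some ?k)" "y' = \<alpha> (Some ?k) y" using eq m n by simp_all
    let ?u = "\<alpha> (Some ?k) (x \<cdot> y)" and ?w = "\<alpha> (Some (inv ?k)) (y' \<cdot> z)"
    have xy: "x \<cdot> y \<in> D (Some ?k)"
      using dom_prod(2) y(1) k X by simp
    have uz: "?u \<cdot> z \<in> D (Some (inv ?k))"
      using dom_prod(1)[of "Some (inv ?k)"] act_inv(1)[OF k xy] k X by simp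
    have yz: "y' \<cdot> z \<in> D (Some (inv ?k))"
      using dom_prod(1)[of "Some (inv ?k)"] act_inv(1)[OF k y(1)] k X y(2) by simp
    have "?u \<in> carrier X" "?w \<in> carrier X"
      using act_carrier[OF xy] act_carrier[OF yz] k by simp_all
    moreover have "d = cls n ?u"
      unfolding d m n using cls_act_group[OF gh xy] by simp
    moreover have "f = cls m ?w"
      unfolding f m n inv_k using cls_act_group[OF gh(2,1)] yz inv_k by simp
    moreover have "cls n (?u \<cdot> z) = cls m (x \<cdot> ?w)"
    proof -
      \<comment> \<open>(LC1) is used at the transition element \<open>?k\<close> between the two
        representatives of the middle letter.\<close>
      have "\<alpha> (Some (inv ?k)) (?u \<cdot> z) = x \<cdot> ?w"
        unfolding y(2) using LC1[OF k X(1,2,4) y(1)] .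
      moreover have "cls m (\<alpha> (Some (inv ?k)) (?u \<cdot> z)) = cls n (?u \<cdot> z)"
        unfolding m n inv_k using cls_act_group[OF gh(2,1)] uz inv_k by simp
      ultimately show ?thesis by simp
    qed
    ultimately show ?thesis
      using a c mn X by (intro resolve[of n m ?u ?w])
  qed
qed

end

theorem theorem3p33:
  fixes G :: "('g, 'b) monoid_scheme" and X :: "('x, 'c) monoid_scheme"
    and D :: "'g option \<Rightarrow> 'x set" and \<alpha> :: "'g option \<Rightarrow> 'x \<Rightarrow> 'x"
  assumes "group G"
    and "strong_partial_action_semigroup (adjoin_zero G) X D \<alpha>"
    and "\<And>m. m \<in> carrier (adjoin_zero G) \<Longrightarrow> semigroup_ideal (D m) X"
    and "\<And>m. m \<in> carrier (adjoin_zero G) \<Longrightarrow> semigroup_ideal (\<alpha> m ` D m) X"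
  shows "locally_confluent_on (nonempty_words (tensor_set (adjoin_zero G) X D \<alpha>))
           (rewrite_step (adjoin_zero G) X D \<alpha>)
     \<longleftrightarrow>
      (\<forall>g\<in>carrier G. \<forall>x\<in>carrier X. \<forall>y\<in>carrier X. \<forall>z\<in>carrier X. y \<in> D (Some g) \<longrightarrow>
         \<alpha> (Some (inv\<^bsub>G\<^esub> g)) (\<alpha> (Some g) (x \<otimes>\<^bsub>X\<^esub> y) \<otimes>\<^bsub>X\<^esub> z)
           = x \<otimes>\<^bsub>X\<^esub> \<alpha> (Some (inv\<^bsub>G\<^esub> g)) (\<alpha> (Some g) y \<otimes>\<^bsub>X\<^esub> z))
    \<and> (\<forall>m\<in>carrier (adjoin_zero G). \<forall>y\<in>D m.
         \<forall>x\<in>carrier (adjoin_one X). \<forall>z\<in>carrier (adjoin_one X).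
           prod1 X x y z \<in> D None \<longrightarrow>
             prod1 X x (\<alpha> m y) z \<in> D None \<and>
             \<alpha> None (prod1 X x y z) = \<alpha> None (prod1 X x (\<alpha> m y) z))
    \<and> (\<forall>g\<in>carrier G. \<forall>h\<in>carrier G. \<forall>x\<in>D (Some g). \<forall>y\<in>D (Some h).
         \<forall>z\<in>carrier (adjoin_one X).
           prod1 X (Some x) y z \<notin> D None \<longrightarrow>
             (\<exists>k\<in>carrier G. prod1 X (Some x) y z \<in> D (Some k) \<and>
               \<alpha> (Some k) (prod1 X (Some x) y z)
                 = prod1 X (Some (\<alpha> (Some g) x)) (\<alpha> (Some h) y) z))"
proof -
  interpret group_zero_partial_action G X D \<alpha>
    by (rule group_zero_partial_action.intro[OF assms(1)
          strong_partial_action_semigroup.axioms(2)[OF assms(2)]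
          group_zero_partial_action_axioms.intro[OF assms(2-4)]])
  have "locally_confluent_on (nonempty_words (tensor_set (adjoin_zero G) X D \<alpha>))
      (rewrite_step (adjoin_zero G) X D \<alpha>) \<longleftrightarrow>
    (\<forall>a b c c'. contract a b c \<and> contract a b c' \<longrightarrow> c = c') \<and>
    (\<forall>a b c d f. contract a b d \<and> contract b c f \<longrightarrow>
       d = a \<and> c = f \<or> (\<exists>s. contract d c s \<and> contract a f s))"
    unfolding rewrite_step_eq by (rule locally_confluent_contraction_iff) (rule contract_in)
  also have "\<dots> \<longleftrightarrow>
    (\<forall>g\<in>carrier G. \<forall>x\<in>carrier X. \<forall>y\<in>carrier X. \<forall>z\<in>carrier X. y \<in> D (Some g) \<longrightarrow>
       \<alpha> (Some (inv\<^bsub>G\<^esub> g)) (\<alpha> (Some g) (x \<otimes>\<^bsub>X\<^esub> y) \<otimes>\<^bsub>X\<^esub> z)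
         = x \<otimes>\<^bsub>X\<^esub> \<alpha> (Some (inv\<^bsub>G\<^esub> g)) (\<alpha> (Some g) y \<otimes>\<^bsub>X\<^esub> z))
    \<and> zero_congruence"
    (is "?det \<and> ?overlap \<longleftrightarrow> ?LC1 \<and> _")
  \<comment> \<open>Uniqueness of contracta is exchanged for \<open>zero_congruence\<close> in both
    directions. (LC1) is drawn from the overlaps alone, whereas resolving the overlaps uses (LC1)
    and the congruence together.\<close>
  proof (intro iffI; elim conjE)
    assume ?det and overlap: ?overlap
    have ?LC1
    proof (intro ballI impI)
      fix g x y z
      assume "g \<in> carrier G" "x \<in> carrier X" "y \<in> carrier X" "z \<in> carrier X" "y \<in> D (Some g)"
      then show "\<alpha> (Some (inv\<^bsub>G\<^esub> g)) (\<alpha> (Some g) (x \<otimes>\<^bsub>X\<^esub> y) \<otimes>\<^bsub>X\<^esub> z)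
          = x \<otimes>\<^bsub>X\<^esub> \<alpha> (Some (inv\<^bsub>G\<^esub> g)) (\<alpha> (Some g) y \<otimes>\<^bsub>X\<^esub> z)"
        using overlap by (intro overlap_imp_LC1) simp_all
    qed
    with \<open>?det\<close> show "?LC1 \<and> zero_congruence"
      by (simp only: contract_deterministic_iff)
  next
    assume LC1: ?LC1 and cong: zero_congruence
    have "\<exists>s. contract d c s \<and> contract a f s" if "contract a b d" "contract b c f" for a b c d f
      by (rule overlap_resolves[OF cong _ that]) (rule LC1[rule_format])
    with cong show "?det \<and> ?overlap"
      by (simp only: contract_deterministic_iff) blast
  qed
  finally show ?thesis
    unfolding zero_congruence_iff .
qed

end
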